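(* Let $\theta>1$, $y\in\mathbb{R}$, $\xi\in(0,1]$, $\bar\theta=\theta^{-1}$ and $\lambda=(1-\bar\theta)\xi$. Then $$\lim_{n\to\infty}\frac{p_n^{\xi,y}(\theta)\,\lambda\,(\bar\theta;\bar\theta)_\infty}{\lambda^{n+1}}=h(y),$$ where $$h(y)=\begin{cases}0, & y>0,\\ e_\theta\left(\frac{1-\xi}{\lambda}\right)\sum_{j=0}^\infty\frac{\left(\frac{-\xi}{\lambda}\right)^j}{[j]_\theta!}e^{\frac{\theta(1-\theta^j)}{1-\theta}y}, & y\le0.\end{cases}$$
   Context: For $\xi\in[0,1]$ let $\phi_\xi(x)=\xi e^{x}$ for $x<0$ and $\phi_\xi(x)=(1-\xi)e^{-x}$ for $x>0$, and let $(X_i)_{i\ge0}$ be i.i.d. with density $\phi_\xi$. For $y\in\mathbb{R}$ put $p_0^{\xi,y}(\theta)=1$ and $p_n^{\xi,y}(\theta)=\mathbb{P}(X_2>\theta y,X_3>\theta X_2,\dots,X_{n+1}>\theta X_n)$ for $n\ge1$. $(a;q)_\infty=\prod_{k=0}^\infty(1-aq^k)$ for $0<q<1$. For $\theta>1$: $[k]_\theta=\frac{1-\theta^k}{1-\theta}$, $[n]_\theta!=\prod_{k=1}^n[k]_\theta$, and $e_\theta(z)=\sum_{n\ge0}\frac{z^n}{[n]_\theta!}$ (an entire function). *)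

theory Defs
  imports "HOL-Probability.Probability"
begin

(* The value at 0 is immaterial, as a density is only determined almost everywhere. *)
definition phi :: "real \<Rightarrow> real \<Rightarrow> real" where
  "phi \<xi> x = (if x < 0 then \<xi> * exp x else (1 - \<xi>) * exp (- x))"

(* The parameter \<xi> enters only through the law of X. For n = 1 the index set {2..n} is empty
   and the event is X 2 > \<theta> y. *)
definition persist_prob :: "'a measure \<Rightarrow> (nat \<Rightarrow> 'a \<Rightarrow> real) \<Rightarrow> real \<Rightarrow> real \<Rightarrow> nat \<Rightarrow> real" where
  "persist_prob M X \<theta> y n =
    (if n = 0 then 1
     else measure M {\<omega> \<in> space M. X 2 \<omega> > \<theta> * y \<and> (\<forall>k\<in>{2..n}. X (k + 1) \<omega> > \<theta> * X k \<omega>)})"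

definition qpoch_inf :: "real \<Rightarrow> real \<Rightarrow> real" where
  "qpoch_inf a q = (\<Prod>k. 1 - a * q ^ k)"

definition q_num :: "real \<Rightarrow> nat \<Rightarrow> real" where
  "q_num \<theta> k = (1 - \<theta> ^ k) / (1 - \<theta>)"

definition q_fact :: "real \<Rightarrow> nat \<Rightarrow> real" where
  "q_fact \<theta> n = (\<Prod>k=1..n. q_num \<theta> k)"

definition q_exp :: "real \<Rightarrow> 'a::{real_normed_field,banach} \<Rightarrow> 'a" where
  "q_exp \<theta> z = (\<Sum>n. z ^ n / of_real (q_fact \<theta> n))"

definition h_lim :: "real \<Rightarrow> real \<Rightarrow> real \<Rightarrow> real \<Rightarrow> real" where
  "h_lim \<theta> \<xi> lam y =
    (if y > 0 then 0
     else q_exp \<theta> ((1 - \<xi>) / lam) *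
       (\<Sum>j. (- \<xi> / lam) ^ j / q_fact \<theta> j * exp (\<theta> * (1 - \<theta> ^ j) / (1 - \<theta>) * y)))"

end

theory Submission
  imports Defs
begin

text \<open>
  Conditioning on the first variable gives $p_{n+1}(y) = \int_{\theta y}^\infty \phi_\xi(x) p_n(x)\,dx$,
  and this recursion has an explicit solution. For $y \ge 0$,
  $p_n(y) = (1-\xi)^n e^{-\theta [n] y} / [n]!$, which is the $n$-th term of an entire series and hence
  negligible against $\lambda^n$. For $y \le 0$, $p_n(y) = \sum_{j \le n} a_{n-j} b_j e^{\theta [j] y}$
  with $b_j = (-\xi)^j/[j]!$, and continuity at $0$ forces the generating function
  $A(z) = e_\theta((1-\xi)z) / e_\theta(-\xi z)$. By Euler's identities
  $1/e_\theta(-\xi z) = 1/(\lambda z; \bar\theta)_\infty = \sum_n \lambda^n z^n / (\bar\theta;\bar\theta)_n$,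
  so $a_n/\lambda^n$ and then $p_n(y)/\lambda^n$ are convolutions of a convergent sequence with
  an absolutely summable one, and their limits can be read off.
\<close>

unbundle fps_syntax

section \<open>Growth of the q-factorials and convergence of the q-exponential series\<close>

lemma q_num_eq_sum: "\<theta> \<noteq> 1 \<Longrightarrow> q_num \<theta> n = (\<Sum>i<n. \<theta> ^ i)"
  unfolding q_num_def by (simp add: sum_gp_strict)

lemma q_num_0 [simp]: "q_num \<theta> 0 = 0"
  by (simp add: q_num_def)

lemma q_num_Suc: "\<theta> \<noteq> 1 \<Longrightarrow> q_num \<theta> (Suc n) = 1 + \<theta> * q_num \<theta> n"
  by (simp add: q_num_def field_simps)

lemma q_num_ge: "\<theta> > 1 \<Longrightarrow> real n \<le> q_num \<theta> n"
  using sum_mono[of "{..<n}" "\<lambda>_. 1" "\<lambda>i. \<theta> ^ i"] by (simp add: q_num_eq_sum)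

lemma q_num_pos: "\<theta> > 1 \<Longrightarrow> n > 0 \<Longrightarrow> 0 < q_num \<theta> n"
  using q_num_ge[of \<theta> n] by simp

lemma q_fact_0 [simp]: "q_fact \<theta> 0 = 1"
  by (simp add: q_fact_def)

lemma q_fact_Suc: "q_fact \<theta> (Suc n) = q_num \<theta> (Suc n) * q_fact \<theta> n"
  by (simp add: q_fact_def)

text \<open>Each factor \<open>q_num \<theta> k\<close> is a sum of k powers of \<theta>, all at
  least 1. Series with q-factorial denominators are therefore dominated by exponential
  series.\<close>

lemma q_fact_ge: "\<theta> > 1 \<Longrightarrow> fact n \<le> q_fact \<theta> n"
proof (induction n)
  case (Suc n)
  have "real (Suc n) * fact n \<le> q_num \<theta> (Suc n) * q_fact \<theta> n"
    using Suc q_num_ge[of \<theta> "Suc n"] by (intro mult_mono) auto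
  then show ?case by (simp add: q_fact_Suc)
qed simp

lemma q_fact_pos: "\<theta> > 1 \<Longrightarrow> 0 < q_fact \<theta> n"
  using q_fact_ge[of \<theta> n] by (meson fact_gt_zero less_le_trans)

lemma summable_norm_q_exp:
  fixes z :: real
  assumes "\<theta> > 1"
  shows "summable (\<lambda>n. norm (z ^ n / q_fact \<theta> n))"
proof (rule summable_comparison_test)
  show "summable (\<lambda>n. norm z ^ n / fact n)"
    using summable_exp[of "norm z"] by (simp add: field_simps)
  have "norm (norm (z ^ n / q_fact \<theta> n)) \<le> norm z ^ n / fact n" for n
    using q_fact_ge[OF assms, of n] q_fact_pos[OF assms, of n]
    by (simp add: power_abs frac_le)
  then show "\<exists>N. \<forall>n\<ge>N. norm (norm (z ^ n / q_fact \<theta> n)) \<le> norm z ^ n / fact n"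
    by blast
qed

section \<open>Limits of convolutions\<close>

text \<open>Tannery's theorem: padded with zeros for \<open>j > n\<close>, the sum is a series whose
  terms tend to \<open>L * g j\<close> and are dominated by \<open>K * norm (g j)\<close>, where
  \<open>K\<close> bounds the convergent sequence \<open>f\<close>.\<close>

lemma tendsto_convolution:
  fixes f g :: "nat \<Rightarrow> real"
  assumes f: "f \<longlonglongrightarrow> L" and g: "summable (\<lambda>n. norm (g n))"
  shows "(\<lambda>n. \<Sum>j\<le>n. f (n - j) * g j) \<longlonglongrightarrow> L * suminf g"
proof -
  obtain K where K: "\<And>n. norm (f n) \<le> K"
    using f convergentI convergent_imp_Bseq BseqE by metis
  have "((\<lambda>n. \<Sum>j. (if j \<le> n then f (n - j) * g j else 0)) \<longlongrightarrow> (\<Sum>j. L * g j)) sequentially"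
  proof (rule tannerys_theorem[THEN conjunct2, THEN conjunct2])
    fix j
    have "(\<lambda>n. f (n - j) * g j) \<longlonglongrightarrow> L * g j"
      by (intro tendsto_mult tendsto_const)
        (use f in \<open>auto intro: filterlim_compose[OF _ filterlim_minus_const_nat_at_top]\<close>)
    then show "(\<lambda>n. if j \<le> n then f (n - j) * g j else 0) \<longlonglongrightarrow> L * g j"
      by (rule Lim_transform_eventually) (rule eventually_mono[OF eventually_ge_at_top[of j]], simp)
  next
    have "K \<ge> 0" using K[of 0] norm_ge_zero order_trans by blast
    then show "\<forall>\<^sub>F (j, n) in sequentially \<times>\<^sub>F sequentially.
        norm (if j \<le> n then f (n - j) * g j else 0) \<le> K * norm (g j)"
      using K by (intro always_eventually) (auto simp: abs_mult intro!: mult_right_mono)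
  qed (use g in \<open>auto intro: summable_mult\<close>)
  moreover have "(\<Sum>j. (if j \<le> n then f (n - j) * g j else 0)) = (\<Sum>j\<le>n. f (n - j) * g j)" for n
    by (subst suminf_finite[of "{..n}"]) auto
  moreover have "(\<Sum>j. L * g j) = L * suminf g"
    by (rule suminf_mult[OF summable_norm_cancel[OF g]])
  ultimately show ?thesis by simp
qed

section \<open>Euler's identities as formal power series, and the infinite product\<close>

text \<open>The series of e_\<theta>(z t) in a formal variable t. Keeping t formal turns generating
  function identities into Cauchy products without any radius of convergence.\<close>

definition q_exp_fps :: "real \<Rightarrow> real \<Rightarrow> real fps" where
  "q_exp_fps \<theta> z = Abs_fps (\<lambda>n. z ^ n / q_fact \<theta> n)"

text \<open>For 0 < q < 1 this is Euler's expansion of 1/(z t; q)_inf in powers of t; the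
  denominators are the finite products (q; q)_n.\<close>

definition euler_fps :: "real \<Rightarrow> real \<Rightarrow> real fps" where
  "euler_fps q z = Abs_fps (\<lambda>n. z ^ n / (\<Prod>k=1..n. 1 - q ^ k))"

text \<open>
  With $B$ and $D$ the two factors, $B(z) = (1 - \lambda z) B(qz)$ and $D(qz) = (1 - \lambda z) D(z)$
  for $q = \theta^{-1}$, so that $BD$ is invariant under $z \mapsto qz$ and therefore constant.
  The relation between consecutive coefficients of $BD$ below is a consequence of both equations.
\<close>
lemma q_exp_fps_mult_euler_fps:
  assumes "\<theta> > 1"
  shows "q_exp_fps \<theta> (- \<xi>) * euler_fps (inverse \<theta>) ((1 - inverse \<theta>) * \<xi>) = 1"
proof -
  define q z where "q = inverse \<theta>" and "z = (1 - q) * \<xi>"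
  define b d where "b = fps_nth (q_exp_fps \<theta> (- \<xi>))" and "d = fps_nth (euler_fps q z)"
  have q: "0 < q" "q < 1" using assms by (auto simp: q_def inverse_less_1_iff)
  have q1: "q ^ Suc n < 1" for n using q by (simp add: power_Suc_less_one del: power_Suc)
  have d0: "d 0 = 1" and b0: "b 0 = 1"
    by (simp_all add: b_def d_def q_exp_fps_def euler_fps_def)
  have d_Suc: "(1 - q ^ Suc n) * d (Suc n) = z * d n" for n
    using q1[of n] by (simp add: d_def euler_fps_def)
  have b_Suc: "(1 - q ^ Suc n) * b (Suc n) = - z * q ^ n * b n" for n
  proof -
    \<comment> \<open>For q = 1/\<theta>, \<open>q_num \<theta> (Suc n)\<close> equals
      \<open>\<theta> ^ n * (1 - q ^ Suc n) / (1 - q)\<close>; the factor \<open>1 - q\<close> in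
      \<open>z\<close> cancels the denominator.\<close>
    have "(1 - q ^ Suc n) * (- \<xi>) = - z * q ^ n * q_num \<theta> (Suc n)"
      using assms unfolding z_def q_def q_num_def
      by (simp add: field_simps)
    then show ?thesis
      using q_num_pos[OF assms, of "Suc n"] q_fact_pos[OF assms, of n]
      by (simp add: b_def q_exp_fps_def q_fact_Suc divide_simps)
  qed
  define B D where "B = q_exp_fps \<theta> (- \<xi>)" and "D = euler_fps q z"
  define s where "s n = (B * D) $ n" for n
  have s: "s n = (\<Sum>j\<le>n. b j * d (n - j))" for n
    by (simp add: s_def fps_mult_nth B_def D_def b_def d_def atLeast0AtMost)
  have step: "(1 - q ^ Suc n) * s (Suc n) = z * (1 - q ^ n) * s n" for n
  proof -
    \<comment> \<open>Write \<open>1 - q ^ Suc n\<close> as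
      \<open>(1 - q ^ (Suc n - j)) + q ^ (Suc n - j) * (1 - q ^ j)\<close>, so that the first
      summand feeds the recursion of \<open>d\<close> and the second that of \<open>b\<close>. The
      term j = n + 1 of the first sum and the term j = 0 of the second vanish.\<close>
    have "(1 - q ^ Suc n) * s (Suc n)
        = (\<Sum>j\<le>Suc n. b j * ((1 - q ^ (Suc n - j)) * d (Suc n - j)))
        + (\<Sum>j\<le>Suc n. q ^ (Suc n - j) * ((1 - q ^ j) * b j) * d (Suc n - j))"
      unfolding s sum_distrib_left sum.distrib[symmetric]
      by (intro sum.cong refl)
        (auto simp: algebra_simps power_add[symmetric] simp del: power_Suc)
    also have "(\<Sum>j\<le>Suc n. b j * ((1 - q ^ (Suc n - j)) * d (Suc n - j)))
        = (\<Sum>j\<le>n. b j * (z * d (n - j)))"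
      by (simp add: Suc_diff_le d_Suc del: power_Suc)
    also have "(\<Sum>j\<le>Suc n. q ^ (Suc n - j) * ((1 - q ^ j) * b j) * d (Suc n - j))
        = (\<Sum>j\<le>n. q ^ (n - j) * (- z * q ^ j * b j) * d (n - j))"
      by (simp add: sum.atMost_Suc_shift b_Suc del: sum.atMost_Suc power_Suc)
    also have "\<dots> = (\<Sum>j\<le>n. - z * q ^ n * (b j * d (n - j)))"
    proof (intro sum.cong refl)
      fix j assume "j \<in> {..n}"
      then have "q ^ n = q ^ (n - j) * q ^ j" by (simp flip: power_add)
      then show "q ^ (n - j) * (- z * q ^ j * b j) * d (n - j) = - z * q ^ n * (b j * d (n - j))"
        by simp
    qed
    finally show ?thesis
      by (simp add: s sum_distrib_left sum.distrib[symmetric] algebra_simps)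
  qed
  \<comment> \<open>The factor \<open>1 - q ^ n\<close> in \<open>step\<close> is 0 at n = 0, which
    kills \<open>s 1\<close> and then all later coefficients.\<close>
  have "s (Suc n) = 0" for n
  proof (induction n)
    case 0
    show ?case using step[of 0] q by simp
  next
    case (Suc n)
    show ?case using step[of "Suc n"] q1[of "Suc n"] Suc by (simp del: power_Suc)
  qed
  moreover have "s 0 = 1" by (simp add: s b0 d0)
  ultimately have "B * D = 1"
    unfolding fps_eq_iff s_def by (metis fps_one_nth nat.exhaust)
  then show ?thesis by (simp add: B_def D_def q_def z_def)
qed

text \<open>A geometric series gives absolute convergence of the product, and no factor vanishes.
  The product in \<open>qpoch_inf q q\<close> runs over \<open>q * q ^ k\<close> from k = 0, hence
  the index shift. The finite products are the denominators in \<open>euler_fps\<close>.\<close>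

lemma
  assumes "0 < q" "q < (1::real)"
  shows qpoch_inf_LIMSEQ: "(\<lambda>n. \<Prod>k=1..n. 1 - q ^ k) \<longlonglongrightarrow> qpoch_inf q q"
    and qpoch_inf_nonzero: "qpoch_inf q q \<noteq> 0"
proof -
  have nz: "1 - q * q ^ k \<noteq> 0" for k
    using assms power_Suc_less_one[of q k] by simp
  have "summable (\<lambda>k. norm ((1 - q * q ^ k) - 1))"
    using assms by (auto simp: abs_mult intro!: summable_mult summable_geometric)
  then have c: "convergent_prod (\<lambda>k. 1 - q * q ^ k)"
    by (intro abs_convergent_prod_imp_convergent_prod summable_imp_abs_convergent_prod)
  show "qpoch_inf q q \<noteq> 0"
    unfolding qpoch_inf_def by (intro prodinf_nonzero c nz)
  have "(\<lambda>n. \<Prod>k=1..Suc n. 1 - q ^ k) = (\<lambda>n. \<Prod>k\<le>n. 1 - q * q ^ k)"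
    by (simp only: One_nat_def prod.atLeast1_atMost_eq lessThan_Suc_atMost power_Suc)
  then have "(\<lambda>n. \<Prod>k=1..Suc n. 1 - q ^ k) \<longlonglongrightarrow> qpoch_inf q q"
    using convergent_prod_LIMSEQ[OF c] unfolding qpoch_inf_def by (simp only:)
  then show "(\<lambda>n. \<Prod>k=1..n. 1 - q ^ k) \<longlonglongrightarrow> qpoch_inf q q"
    by (rule LIMSEQ_imp_Suc)
qed

section \<open>The explicit solution and its asymptotics\<close>

text \<open>The candidate for p_n on the half-line x >= 0, written as a formula on the whole line so
  that it can be differentiated at 0 as well.\<close>

definition persist_pos :: "real \<Rightarrow> real \<Rightarrow> nat \<Rightarrow> real \<Rightarrow> real" where
  "persist_pos \<theta> \<xi> n x = q_exp_fps \<theta> (1 - \<xi>) $ n * exp (- \<theta> * q_num \<theta> n * x)"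

text \<open>The candidate for p_n on x <= 0. For \<theta> > 1 the \<open>euler_fps\<close> factor is
  the reciprocal of e_\<theta>(-\<xi> t), so the product of the first two series is the generating
  function A of the coefficients a_n.\<close>

definition persist_neg :: "real \<Rightarrow> real \<Rightarrow> nat \<Rightarrow> real \<Rightarrow> real" where
  "persist_neg \<theta> \<xi> n x =
    (\<Sum>j\<le>n. (q_exp_fps \<theta> (1 - \<xi>) * euler_fps (inverse \<theta>) ((1 - inverse \<theta>) * \<xi>)) $ (n - j)
            * q_exp_fps \<theta> (- \<xi>) $ j * exp (\<theta> * q_num \<theta> j * x))"

text \<open>At 0 all exponentials are 1 and the sum is a Cauchy product in which the series of
  e_\<theta>(-\<xi> t) cancels its reciprocal. The value is that of \<open>persist_pos\<close> at 0,
  so the two branches match.\<close>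

lemma persist_neg_0:
  assumes "\<theta> > 1"
  shows "persist_neg \<theta> \<xi> n 0 = q_exp_fps \<theta> (1 - \<xi>) $ n"
proof -
  let ?C = "q_exp_fps \<theta> (1 - \<xi>)" and ?B = "q_exp_fps \<theta> (- \<xi>)"
  let ?D = "euler_fps (inverse \<theta>) ((1 - inverse \<theta>) * \<xi>)"
  have "persist_neg \<theta> \<xi> n 0 = (?B * (?C * ?D)) $ n"
    unfolding persist_neg_def fps_mult_nth[of ?B] by (simp add: atLeast0AtMost mult.commute)
  also have "?B * (?C * ?D) = ?C * (?B * ?D)" by (simp add: mult_ac)
  finally show ?thesis by (simp add: q_exp_fps_mult_euler_fps[OF assms])
qed

lemma persist_pos_limit:
  assumes "\<theta> > 1" "lam > 0" "y \<ge> 0" "\<xi> \<le> 1"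
  shows "(\<lambda>n. persist_pos \<theta> \<xi> n y / lam ^ n) \<longlonglongrightarrow> 0"
proof (rule Lim_null_comparison)
  have "norm (persist_pos \<theta> \<xi> n y / lam ^ n) \<le> norm (((1 - \<xi>) / lam) ^ n / q_fact \<theta> n)" for n
  proof -
    have "exp (- \<theta> * q_num \<theta> n * y) \<le> 1"
      using assms q_num_ge[OF assms(1), of n] by (simp add: mult_nonneg_nonneg)
    then have "\<bar>((1 - \<xi>) / lam) ^ n / q_fact \<theta> n\<bar> * exp (- \<theta> * q_num \<theta> n * y)
        \<le> \<bar>((1 - \<xi>) / lam) ^ n / q_fact \<theta> n\<bar>"
      by (intro mult_right_le_one_le) auto
    then show ?thesis
      by (simp add: persist_pos_def q_exp_fps_def abs_mult power_divide mult.commute)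
  qed
  then show "\<forall>\<^sub>F n in sequentially.
      norm (persist_pos \<theta> \<xi> n y / lam ^ n) \<le> norm (((1 - \<xi>) / lam) ^ n / q_fact \<theta> n)"
    by simp
  show "(\<lambda>n. norm (((1 - \<xi>) / lam) ^ n / q_fact \<theta> n)) \<longlonglongrightarrow> 0"
    using summable_norm_q_exp[OF assms(1)] by (rule summable_LIMSEQ_zero)
qed

text \<open>Two nested uses of \<open>tendsto_convolution\<close>: first for a_n / lam^n, then for
  the sum over j that forms \<open>persist_neg\<close>.\<close>

lemma persist_neg_limit:
  assumes "\<theta> > 1" "y \<le> 0" "\<xi> > 0" and lam: "lam = (1 - inverse \<theta>) * \<xi>"
  shows "(\<lambda>n. persist_neg \<theta> \<xi> n y / lam ^ n) \<longlonglongrightarrow>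
    q_exp \<theta> ((1 - \<xi>) / lam) / qpoch_inf (inverse \<theta>) (inverse \<theta>) *
    (\<Sum>j. (- \<xi> / lam) ^ j / q_fact \<theta> j * exp (\<theta> * q_num \<theta> j * y))"
proof -
  let ?C = "q_exp_fps \<theta> (1 - \<xi>)" and ?q = "inverse \<theta>"
  let ?D = "euler_fps ?q lam"
  have q: "0 < ?q" "?q < 1" using assms by (auto simp: inverse_less_1_iff)
  then have lam0: "lam > 0" using assms by simp
  \<comment> \<open>Dividing the coefficients of \<open>?D\<close> by powers of \<open>lam\<close>
    leaves exactly 1/(q; q)_n, a sequence with a finite limit; the other factor is summable.\<close>
  have "(\<lambda>n. \<Sum>j\<le>n. 1 / (\<Prod>k=1..n - j. 1 - ?q ^ k) * (((1 - \<xi>) / lam) ^ j / q_fact \<theta> j))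
      \<longlonglongrightarrow> 1 / qpoch_inf ?q ?q * (\<Sum>j. ((1 - \<xi>) / lam) ^ j / q_fact \<theta> j)"
    by (intro tendsto_convolution tendsto_intros qpoch_inf_LIMSEQ qpoch_inf_nonzero q
        summable_norm_q_exp assms)
  also have "(\<lambda>n. \<Sum>j\<le>n. 1 / (\<Prod>k=1..n - j. 1 - ?q ^ k) * (((1 - \<xi>) / lam) ^ j / q_fact \<theta> j))
      = (\<lambda>n. (?C * ?D) $ n / lam ^ n)"
  proof
    fix n
    have "1 / (\<Prod>k=1..n - j. 1 - ?q ^ k) * (((1 - \<xi>) / lam) ^ j / q_fact \<theta> j)
        = ?C $ j * ?D $ (n - j) / lam ^ n" if "j \<le> n" for j
    proof -
      have "lam ^ n = lam ^ j * lam ^ (n - j)" using that by (simp flip: power_add)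
      then show ?thesis
        using lam0 by (simp add: q_exp_fps_def euler_fps_def power_divide)
    qed
    then show "(\<Sum>j\<le>n. 1 / (\<Prod>k=1..n - j. 1 - ?q ^ k) * (((1 - \<xi>) / lam) ^ j / q_fact \<theta> j))
        = (?C * ?D) $ n / lam ^ n"
      by (simp add: fps_mult_nth sum_divide_distrib atLeast0AtMost)
  qed
  finally have A: "(\<lambda>n. (?C * ?D) $ n / lam ^ n)
      \<longlonglongrightarrow> q_exp \<theta> ((1 - \<xi>) / lam) / qpoch_inf ?q ?q"
    by (simp add: q_exp_def)
  have "summable (\<lambda>j. norm ((- \<xi> / lam) ^ j / q_fact \<theta> j * exp (\<theta> * q_num \<theta> j * y)))"
  proof (rule summable_comparison_test)
    show "summable (\<lambda>j. norm ((- \<xi> / lam) ^ j / q_fact \<theta> j))"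
      by (rule summable_norm_q_exp[OF assms(1)])
    have le: "exp (\<theta> * q_num \<theta> j * y) \<le> 1" for j
      using assms q_num_ge[OF assms(1), of j] by (simp add: mult_nonneg_nonpos)
    have "norm (norm (a * b)) \<le> norm a" if "0 \<le> b" "b \<le> 1" for a b :: real
      using that by (simp add: abs_mult mult_right_le_one_le)
    from this[OF exp_ge_zero le]
    have "norm (norm ((- \<xi> / lam) ^ j / q_fact \<theta> j * exp (\<theta> * q_num \<theta> j * y)))
        \<le> norm ((- \<xi> / lam) ^ j / q_fact \<theta> j)" for j .
    then show "\<exists>N. \<forall>j\<ge>N. norm (norm ((- \<xi> / lam) ^ j / q_fact \<theta> j * exp (\<theta> * q_num \<theta> j * y)))
        \<le> norm ((- \<xi> / lam) ^ j / q_fact \<theta> j)"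
      by blast
  qed
  from tendsto_convolution[OF A this]
  show ?thesis
  proof (rule Lim_transform_eventually, intro always_eventually allI)
    fix n
    have "(?C * ?D) $ (n - j) / lam ^ (n - j) *
          ((- \<xi> / lam) ^ j / q_fact \<theta> j * exp (\<theta> * q_num \<theta> j * y))
        = (?C * ?D) $ (n - j) * q_exp_fps \<theta> (- \<xi>) $ j * exp (\<theta> * q_num \<theta> j * y) / lam ^ n"
      if "j \<le> n" for j
    proof -
      have "lam ^ n = lam ^ j * lam ^ (n - j)" using that by (simp flip: power_add)
      then show ?thesis by (simp only: q_exp_fps_def power_divide) (simp add: mult_ac)
    qed
    then show "(\<Sum>j\<le>n. (?C * ?D) $ (n - j) / lam ^ (n - j) *
          ((- \<xi> / lam) ^ j / q_fact \<theta> j * exp (\<theta> * q_num \<theta> j * y)))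
        = persist_neg \<theta> \<xi> n y / lam ^ n"
      by (simp add: persist_neg_def sum_divide_distrib lam)
  qed
qed


section \<open>The integral recursion for the explicit solution\<close>

definition persist :: "real \<Rightarrow> real \<Rightarrow> nat \<Rightarrow> real \<Rightarrow> real" where
  "persist \<theta> \<xi> n x = (if x < 0 then persist_neg \<theta> \<xi> n x else persist_pos \<theta> \<xi> n x)"

lemma persist_0 [simp]: "persist \<theta> \<xi> 0 x = 1"
  by (simp add: persist_def persist_neg_def persist_pos_def q_exp_fps_def euler_fps_def)

lemma persist_eq_neg:
  assumes "\<theta> > 1" "x \<le> 0"
  shows "persist \<theta> \<xi> n x = persist_neg \<theta> \<xi> n x"
  using assms persist_neg_0[OF assms(1), of \<xi> n]
  by (cases "x = 0") (auto simp: persist_def persist_pos_def)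

lemma q_exp_fps_Suc:
  assumes "\<theta> > 1"
  shows "q_num \<theta> (Suc n) * q_exp_fps \<theta> z $ Suc n = z * q_exp_fps \<theta> z $ n"
  using q_num_pos[OF assms, of "Suc n"] by (simp add: q_exp_fps_def q_fact_Suc)

text \<open>This is the recursion in differential form: at x/\<theta> the lower limit of integration
  is x, so the derivative is minus the integrand. It rests on [n+1] = 1 + \<theta> [n], which splits
  off the density factor \<open>exp (- x)\<close>.\<close>

lemma persist_pos_deriv:
  assumes "\<theta> > 1"
  shows "((\<lambda>x. persist_pos \<theta> \<xi> (Suc n) (x / \<theta>)) has_real_derivative
            - ((1 - \<xi>) * exp (- x) * persist_pos \<theta> \<xi> n x)) (at x)"
proof -
  let ?c = "q_exp_fps \<theta> (1 - \<xi>)" and ?N = "q_num \<theta> (Suc n)"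
  have "((\<lambda>x. ?c $ Suc n * exp (- (?N * x))) has_real_derivative
            ?c $ Suc n * (exp (- (?N * x)) * (- ?N))) (at x)"
    by (auto intro!: derivative_eq_intros)
  also have "(\<lambda>x. ?c $ Suc n * exp (- (?N * x))) = (\<lambda>x. persist_pos \<theta> \<xi> (Suc n) (x / \<theta>))"
    using assms by (simp add: persist_pos_def)
  also have "?c $ Suc n * (exp (- (?N * x)) * (- ?N)) = - (?N * ?c $ Suc n) * exp (- (?N * x))"
    by simp
  also have "\<dots> = - ((1 - \<xi>) * exp (- x) * persist_pos \<theta> \<xi> n x)"
    unfolding q_exp_fps_Suc[OF assms] using assms
    by (simp add: persist_pos_def q_num_Suc algebra_simps exp_add[symmetric])
  finally show ?thesis .
qed

lemma persist_neg_deriv: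
  assumes "\<theta> > 1"
  shows "((\<lambda>x. persist_neg \<theta> \<xi> (Suc n) (x / \<theta>)) has_real_derivative
            - (\<xi> * exp x * persist_neg \<theta> \<xi> n x)) (at x)"
proof -
  let ?b = "\<lambda>n. q_exp_fps \<theta> (- \<xi>) $ n" and ?N = "q_num \<theta>"
  let ?a = "\<lambda>n. (q_exp_fps \<theta> (1 - \<xi>) * euler_fps (inverse \<theta>) ((1 - inverse \<theta>) * \<xi>)) $ n"
  have "((\<lambda>x. \<Sum>j\<le>Suc n. ?a (Suc n - j) * ?b j * exp (?N j * x)) has_real_derivative
            (\<Sum>j\<le>Suc n. ?a (Suc n - j) * ?b j * (exp (?N j * x) * ?N j))) (at x)"
    by (intro DERIV_sum) (auto intro!: derivative_eq_intros)
  also have "(\<lambda>x. \<Sum>j\<le>Suc n. ?a (Suc n - j) * ?b j * exp (?N j * x))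
      = (\<lambda>x. persist_neg \<theta> \<xi> (Suc n) (x / \<theta>))"
    using assms by (simp add: persist_neg_def)
  \<comment> \<open>The constant term j = 0 drops out because [0] = 0, and the remaining terms are
    shifted by one.\<close>
  also have "(\<Sum>j\<le>Suc n. ?a (Suc n - j) * ?b j * (exp (?N j * x) * ?N j))
      = (\<Sum>j\<le>n. ?a (n - j) * (?N (Suc j) * ?b (Suc j)) * exp (?N (Suc j) * x))"
    by (simp add: sum.atMost_Suc_shift mult_ac del: sum.atMost_Suc)
  also have "\<dots> = - (\<xi> * exp x * persist_neg \<theta> \<xi> n x)"
    unfolding q_exp_fps_Suc[OF assms] persist_neg_def sum_distrib_left sum_negf[symmetric]
    using assms by (intro sum.cong refl) (simp add: q_num_Suc exp_add algebra_simps)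
  finally show ?thesis .
qed

lemma measurable_persist_pos [measurable]: "persist_pos \<theta> \<xi> n \<in> borel_measurable borel"
  unfolding persist_pos_def by measurable

lemma measurable_persist_neg [measurable]: "persist_neg \<theta> \<xi> n \<in> borel_measurable borel"
  unfolding persist_neg_def by measurable

lemma measurable_persist [measurable]: "persist \<theta> \<xi> n \<in> borel_measurable borel"
  unfolding persist_def by measurable

lemma measurable_phi [measurable]: "phi \<xi> \<in> borel_measurable borel"
  unfolding phi_def by measurable

lemma persist_pos_nonneg: "\<theta> > 1 \<Longrightarrow> \<xi> \<le> 1 \<Longrightarrow> 0 \<le> persist_pos \<theta> \<xi> n x"
  using q_fact_pos[of \<theta> n] by (simp add: persist_pos_def q_exp_fps_def)

lemma persist_neg_Suc_le:
  assumes "\<theta> > 1" "0 \<le> \<xi>" "y \<le> 0" "\<And>x. x \<le> 0 \<Longrightarrow> 0 \<le> persist_neg \<theta> \<xi> n x"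
  shows "persist_neg \<theta> \<xi> (Suc n) 0 \<le> persist_neg \<theta> \<xi> (Suc n) y"
proof -
  let ?F = "\<lambda>x. persist_neg \<theta> \<xi> (Suc n) (x / \<theta>)"
  have "\<theta> * y \<le> 0" using assms by (simp add: mult_nonneg_nonpos)
  then have "?F (\<theta> * y) \<ge> ?F 0"
  proof (rule DERIV_nonpos_imp_nonincreasing)
    fix x :: real assume "x \<le> 0"
    then have "- (\<xi> * exp x * persist_neg \<theta> \<xi> n x) \<le> 0" using assms by simp
    then show "\<exists>D. (?F has_real_derivative D) (at x) \<and> D \<le> 0"
      using persist_neg_deriv[OF assms(1)] by blast
  qed
  then show ?thesis using assms by simp
qed

text \<open>The summands of \<open>persist_neg\<close> carry (-\<xi>)^j, so the sign cannot be read
  off termwise. Inductively, nonnegativity at n makes the next function nonincreasing on x <= 0,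
  hence at least its value at 0, which is a value of \<open>persist_pos\<close>.\<close>

lemma persist_nonneg:
  assumes "\<theta> > 1" "0 \<le> \<xi>" "\<xi> \<le> 1"
  shows "0 \<le> persist \<theta> \<xi> n x"
proof (induction n arbitrary: x)
  case (Suc n)
  show ?case
  proof (cases "x < 0")
    case True
    have "0 \<le> persist_neg \<theta> \<xi> n x" if "x \<le> 0" for x
      using Suc[of x] that by (simp add: persist_eq_neg[OF assms(1)])
    then have "persist_neg \<theta> \<xi> (Suc n) 0 \<le> persist_neg \<theta> \<xi> (Suc n) x"
      using assms True by (intro persist_neg_Suc_le) auto
    moreover have "0 \<le> persist_neg \<theta> \<xi> (Suc n) 0"
      using persist_pos_nonneg[OF assms(1,3), of "Suc n" 0]
      by (simp add: persist_neg_0[OF assms(1)] persist_pos_def)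
    ultimately show ?thesis using True by (simp add: persist_def)
  qed (simp add: persist_def persist_pos_nonneg assms)
qed simp

text \<open>For y >= 0 only the positive branch occurs; its antiderivative
  \<open>- persist_pos \<theta> \<xi> (Suc n) (x / \<theta>)\<close> tends to 0 at infinity because
  [n+1] > 0.\<close>

lemma nn_integral_persist_pos:
  assumes "\<theta> > 1" "\<xi> \<le> 1" "y \<ge> 0"
  shows "(\<integral>\<^sup>+x. ennreal (phi \<xi> x * persist \<theta> \<xi> n x) * indicator {\<theta> * y..} x \<partial>lborel)
    = ennreal (persist_pos \<theta> \<xi> (Suc n) y)"
proof -
  have ty: "0 \<le> \<theta> * y" using assms by simp
  have "(\<integral>\<^sup>+x. ennreal (phi \<xi> x * persist \<theta> \<xi> n x) * indicator {\<theta> * y..} x \<partial>lborel)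
      = (\<integral>\<^sup>+x. ennreal ((1 - \<xi>) * exp (- x) * persist_pos \<theta> \<xi> n x) * indicator {\<theta> * y..} x \<partial>lborel)"
    using ty by (intro nn_integral_cong) (auto simp: phi_def persist_def indicator_def)
  also have "\<dots> = ennreal (0 - (- persist_pos \<theta> \<xi> (Suc n) (\<theta> * y / \<theta>)))"
  proof (rule nn_integral_FTC_atLeast)
    show "(\<lambda>x. (1 - \<xi>) * exp (- x) * persist_pos \<theta> \<xi> n x) \<in> borel_measurable borel"
      by measurable
    show "((\<lambda>x. - persist_pos \<theta> \<xi> (Suc n) (x / \<theta>)) has_real_derivative
        (1 - \<xi>) * exp (- x) * persist_pos \<theta> \<xi> n x) (at x)" for x
      using DERIV_minus[OF persist_pos_deriv[OF assms(1)]] by simp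
    show "0 \<le> (1 - \<xi>) * exp (- x) * persist_pos \<theta> \<xi> n x" for x
      using assms persist_pos_nonneg by simp
    have "filterlim (\<lambda>x. - (q_num \<theta> (Suc n) * x)) at_bot at_top"
      unfolding filterlim_uminus_at_bot minus_minus
      by (intro filterlim_tendsto_pos_mult_at_top[OF tendsto_const _ filterlim_ident]
          q_num_pos assms zero_less_Suc)
    then have "((\<lambda>x. exp (- (q_num \<theta> (Suc n) * x))) \<longlongrightarrow> 0) at_top"
      by (rule filterlim_compose[OF exp_at_bot])
    from tendsto_mult_right_zero[OF this, of "- q_exp_fps \<theta> (1 - \<xi>) $ Suc n"]
    show "((\<lambda>x. - persist_pos \<theta> \<xi> (Suc n) (x / \<theta>)) \<longlongrightarrow> 0) at_top"
      using assms by (simp add: persist_pos_def)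
  qed
  finally show ?thesis using assms by simp
qed

lemma nn_integral_persist:
  assumes "\<theta> > 1" "0 \<le> \<xi>" "\<xi> \<le> 1"
  shows "(\<integral>\<^sup>+x. ennreal (phi \<xi> x * persist \<theta> \<xi> n x) * indicator {\<theta> * y<..} x \<partial>lborel)
    = ennreal (persist \<theta> \<xi> (Suc n) y)"
proof -
  let ?g = "\<lambda>x. ennreal (phi \<xi> x * persist \<theta> \<xi> n x)"
  have "(\<integral>\<^sup>+x. ?g x * indicator {\<theta> * y<..} x \<partial>lborel) = (\<integral>\<^sup>+x. ?g x * indicator {\<theta> * y..} x \<partial>lborel)"
    by (intro nn_integral_cong_AE, use AE_lborel_singleton[of "\<theta> * y"] in eventually_elim)
      (auto simp: indicator_def)
  also have "\<dots> = ennreal (persist \<theta> \<xi> (Suc n) y)"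
  proof (cases "y < 0")
    case False
    then show ?thesis using nn_integral_persist_pos[OF assms(1,3)] by (simp add: persist_def)
  next
    case True
    then have ty: "\<theta> * y \<le> 0" using assms by (simp add: mult_nonneg_nonpos)
    have f_nonneg: "0 \<le> \<xi> * exp x * persist_neg \<theta> \<xi> n x" if "x \<le> 0" for x
      using persist_nonneg[OF assms, of n x] assms that by (simp add: persist_eq_neg)
    let ?F = "\<lambda>x. - persist_neg \<theta> \<xi> (Suc n) (x / \<theta>)"
    have F: "(?F has_real_derivative \<xi> * exp x * persist_neg \<theta> \<xi> n x) (at x)" for x
      using DERIV_minus[OF persist_neg_deriv[OF assms(1)]] by simp
    have le: "persist_neg \<theta> \<xi> (Suc n) 0 \<le> persist_neg \<theta> \<xi> (Suc n) y"
      using assms True persist_nonneg[OF assms, of n]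
      by (intro persist_neg_Suc_le) (auto simp: persist_eq_neg[symmetric])
    \<comment> \<open>For y < 0 the integral is cut at 0, where both the density and the solution
      change their formula; the doubly covered point 0 is a null set.\<close>
    have "(\<integral>\<^sup>+x. ?g x * indicator {\<theta> * y..} x \<partial>lborel)
        = (\<integral>\<^sup>+x. ennreal (\<xi> * exp x * persist_neg \<theta> \<xi> n x) * indicator {\<theta> * y..0} x
              + ?g x * indicator {0..} x \<partial>lborel)"
      by (intro nn_integral_cong_AE, use AE_lborel_singleton[of 0] in eventually_elim)
        (use ty in \<open>auto simp: indicator_def phi_def persist_def\<close>)
    also have "\<dots> = (\<integral>\<^sup>+x. ennreal (\<xi> * exp x * persist_neg \<theta> \<xi> n x) * indicator {\<theta> * y..0} x \<partial>lborel)
              + (\<integral>\<^sup>+x. ?g x * indicator {0..} x \<partial>lborel)"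
    by (intro nn_integral_add) measurable
    also have "(\<integral>\<^sup>+x. ennreal (\<xi> * exp x * persist_neg \<theta> \<xi> n x) * indicator {\<theta> * y..0} x \<partial>lborel)
        = ennreal (?F 0 - ?F (\<theta> * y))"
      by (rule nn_integral_FTC_Icc[OF _ _ _ ty])
        (simp_all add: f_nonneg has_field_derivative_at_within[OF F])
    also have "(\<integral>\<^sup>+x. ?g x * indicator {0..} x \<partial>lborel) = ennreal (persist_pos \<theta> \<xi> (Suc n) 0)"
      using nn_integral_persist_pos[OF assms(1,3), of 0 n] by simp
    also have "ennreal (?F 0 - ?F (\<theta> * y)) + ennreal (persist_pos \<theta> \<xi> (Suc n) 0)
        = ennreal (?F 0 - ?F (\<theta> * y) + persist_pos \<theta> \<xi> (Suc n) 0)"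
      using le assms persist_pos_nonneg[OF assms(1,3)] by (simp add: ennreal_plus)
    \<comment> \<open>Here the matching of the branches enters: the boundary term of
      \<open>persist_neg\<close> at 0 cancels the whole contribution of the positive
      half-line.\<close>
    also have "?F 0 - ?F (\<theta> * y) + persist_pos \<theta> \<xi> (Suc n) 0 = persist \<theta> \<xi> (Suc n) y"
      using assms True by (simp add: persist_neg_0 persist_pos_def persist_def)
    finally show ?thesis .
  qed
  finally show ?thesis .
qed

section \<open>Conditioning on the first variable of a chain\<close>

text \<open>\<open>n\<close> counts the comparisons, \<open>m\<close> is the index of the next
  variable and \<open>x\<close> the value preceding it. With the last two as parameters, the event
  left after fixing one variable has the same shape.\<close>

primrec persist_chain :: "real \<Rightarrow> (nat \<Rightarrow> real) \<Rightarrow> nat \<Rightarrow> nat \<Rightarrow> real \<Rightarrow> bool" where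
  "persist_chain \<theta> f 0 m x = True"
| "persist_chain \<theta> f (Suc n) m x = (\<theta> * x < f m \<and> persist_chain \<theta> f n (Suc m) (f m))"

lemma persist_chain_cong:
  "(\<And>i. i \<in> {m..<m + n} \<Longrightarrow> f i = g i) \<Longrightarrow> persist_chain \<theta> f n m x = persist_chain \<theta> g n m x"
proof (induction n arbitrary: m x)
  case (Suc n)
  have "persist_chain \<theta> f n (Suc m) x = persist_chain \<theta> g n (Suc m) x" for x
    by (rule Suc.IH) (use Suc.prems in auto)
  moreover have "f m = g m" using Suc.prems by auto
  ultimately show ?case by simp
qed simp

lemma persist_chain_Suc_iff:
  "persist_chain \<theta> f (Suc n) m x \<longleftrightarrow> \<theta> * x < f m \<and> (\<forall>k\<in>{m..<m + n}. \<theta> * f k < f (Suc k))"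
proof (induction n arbitrary: m x)
  case (Suc n)
  have "{m..<m + Suc n} = insert m {Suc m..<Suc m + n}" by auto
  then show ?case by (subst persist_chain.simps(2), subst Suc.IH) auto
qed simp

text \<open>The preceding value \<open>x\<close> may depend on \<open>w\<close>, since in the
  induction it becomes the coordinate \<open>g w m\<close>.\<close>

lemma measurable_persist_chain:
  assumes "x \<in> borel_measurable N"
    and "\<And>i. i \<in> {m..<m + n} \<Longrightarrow> (\<lambda>w. g w i) \<in> borel_measurable N"
  shows "Measurable.pred N (\<lambda>w. persist_chain \<theta> (g w) n m (x w))"
  using assms
proof (induction n arbitrary: m x)
  case (Suc n)
  have m: "(\<lambda>w. g w m) \<in> borel_measurable N" by (rule Suc.prems) auto
  have "Measurable.pred N (\<lambda>w. persist_chain \<theta> (g w) n (Suc m) (g w m))"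
    by (rule Suc.IH[OF m]) (use Suc.prems in auto)
  with m Suc.prems(1) show ?case by simp
qed simp

text \<open>\<open>X m\<close> is independent of the later variables, so the joint law is a product
  measure. Fubini integrates the probability \<open>h\<close> of the remaining chain against the law
  of \<open>X m\<close>.\<close>

lemma (in prob_space) emeasure_persist_chain_Suc:
  fixes X :: "nat \<Rightarrow> 'a \<Rightarrow> real"
  assumes ind: "indep_vars (\<lambda>_. borel) X UNIV"
    and dist: "distributed M lborel (X m) f"
    and h: "\<And>x. emeasure M {\<omega> \<in> space M. persist_chain \<theta> (\<lambda>i. X i \<omega>) n (Suc m) x} = h x"
    and [measurable]: "h \<in> borel_measurable borel"
  shows "emeasure M {\<omega> \<in> space M. persist_chain \<theta> (\<lambda>i. X i \<omega>) (Suc n) m y} =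
    (\<integral>\<^sup>+x. f x * (h x * indicator {\<theta> * y<..} x) \<partial>lborel)"
proof -
  \<comment> \<open>The remaining chain reads only the indices in \<open>K\<close>. \<open>Z\<close>
    packs \<open>X m\<close> into a function on \<open>{m}\<close>, so that independence of disjoint
    blocks of variables applies to \<open>Z\<close> and \<open>Y\<close>.\<close>
  define K where "K = {Suc m..<Suc m + n}"
  define P Q :: "(nat \<Rightarrow> real) measure"
    where "P = PiM K (\<lambda>_. borel)" and "Q = PiM {m} (\<lambda>_. borel)"
  define Y Z where "Y \<omega> = restrict (\<lambda>i. X i \<omega>) K"
    and "Z \<omega> = restrict (\<lambda>i. X i \<omega>) {m}" for \<omega>
  have X [measurable]: "random_variable borel (X i)" for i
    using ind unfolding indep_vars_def by auto
  have Y [measurable]: "Y \<in> measurable M P" and Z [measurable]: "Z \<in> measurable M Q"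
    unfolding Y_def P_def Z_def Q_def by measurable
  have "indep_var Q Z P Y"
    unfolding Y_def P_def Z_def Q_def by (intro indep_var_restrict[OF ind]) (auto simp: K_def)
  then have joint: "distr M Q Z \<Otimes>\<^sub>M distr M P Y = distr M (Q \<Otimes>\<^sub>M P) (\<lambda>\<omega>. (Z \<omega>, Y \<omega>))"
    by (simp add: indep_var_distribution_eq)
  define A where "A = {w \<in> space (Q \<Otimes>\<^sub>M P).
    \<theta> * y < fst w m \<and> persist_chain \<theta> (snd w) n (Suc m) (fst w m)}"
  have m [measurable]: "(\<lambda>w. fst w m) \<in> borel_measurable (Q \<Otimes>\<^sub>M P)"
    unfolding Q_def by measurable
  have [measurable]: "Measurable.pred (Q \<Otimes>\<^sub>M P) (\<lambda>w. persist_chain \<theta> (snd w) n (Suc m) (fst w m))"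
  proof (rule measurable_persist_chain[OF m])
    show "(\<lambda>w. snd w i) \<in> borel_measurable (Q \<Otimes>\<^sub>M P)" if "i \<in> {Suc m..<Suc m + n}" for i
      using that unfolding P_def K_def by measurable
  qed
  have A [measurable]: "A \<in> sets (Q \<Otimes>\<^sub>M P)"
    unfolding A_def by measurable
  have chain_Y: "persist_chain \<theta> (Y \<omega>) n (Suc m) x = persist_chain \<theta> (\<lambda>i. X i \<omega>) n (Suc m) x" for \<omega> x
    by (rule persist_chain_cong) (simp add: Y_def K_def)
  have Zm: "Z \<omega> m = X m \<omega>" for \<omega> by (simp add: Z_def)
  have sp: "Y \<omega> \<in> space P" "Z \<omega> \<in> space Q" if "\<omega> \<in> space M" for \<omega>
    using measurable_space[OF Y that] measurable_space[OF Z that] .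
  interpret Y: prob_space "distr M P Y" by (rule prob_space_distr) measurable
  have "emeasure M {\<omega> \<in> space M. persist_chain \<theta> (\<lambda>i. X i \<omega>) (Suc n) m y}
      = emeasure (distr M (Q \<Otimes>\<^sub>M P) (\<lambda>\<omega>. (Z \<omega>, Y \<omega>))) A"
    by (subst emeasure_distr)
      (auto simp: A_def chain_Y sp Zm space_pair_measure intro!: arg_cong[where f = "emeasure M"])
  also have "\<dots> = (\<integral>\<^sup>+g. emeasure (distr M P Y) (Pair g -` A) \<partial>distr M Q Z)"
    unfolding joint[symmetric] by (intro Y.emeasure_pair_measure_alt) (simp cong: sets_pair_measure_cong)
  also have "\<dots> = (\<integral>\<^sup>+\<omega>. emeasure (distr M P Y) (Pair (Z \<omega>) -` A) \<partial>M)"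
    by (intro nn_integral_distr Z Y.measurable_emeasure_Pair) (simp cong: sets_pair_measure_cong)
  also have "\<dots> = (\<integral>\<^sup>+\<omega>. h (X m \<omega>) * indicator {\<theta> * y<..} (X m \<omega>) \<partial>M)"
  proof (intro nn_integral_cong)
    fix \<omega> assume "\<omega> \<in> space M"
    \<comment> \<open>The section of \<open>A\<close> at a fixed first value is the event of the
      remaining chain started at that value, or empty if the first comparison fails.\<close>
    then have "Y -` (Pair (Z \<omega>) -` A) \<inter> space M = (if \<theta> * y < X m \<omega>
        then {\<omega>' \<in> space M. persist_chain \<theta> (\<lambda>i. X i \<omega>') n (Suc m) (X m \<omega>)} else {})"
      by (auto simp: A_def chain_Y sp Zm space_pair_measure)
    then show "emeasure (distr M P Y) (Pair (Z \<omega>) -` A)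
        = h (X m \<omega>) * indicator {\<theta> * y<..} (X m \<omega>)"
      by (simp add: emeasure_distr[OF Y sets_Pair1[OF A]] h)
  qed
  also have "\<dots> = (\<integral>\<^sup>+x. f x * (h x * indicator {\<theta> * y<..} x) \<partial>lborel)"
    by (intro distributed_nn_integral[OF dist, symmetric]) measurable
  finally show ?thesis .
qed

text \<open>Induction on \<open>n\<close> with \<open>m\<close> and \<open>y\<close> free: the
  remaining chain starts at index \<open>m + 1\<close> from the value just integrated over. Its
  probability does not depend on \<open>m\<close> because all variables have the same law.\<close>

lemma (in prob_space) emeasure_persist_chain:
  fixes X :: "nat \<Rightarrow> 'a \<Rightarrow> real"
  assumes ind: "indep_vars (\<lambda>_. borel) X UNIV"
    and dist: "\<And>i. distributed M lborel (X i) (\<lambda>x. ennreal (phi \<xi> x))"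
    and \<theta>: "\<theta> > 1" "0 \<le> \<xi>" "\<xi> \<le> 1"
  shows "emeasure M {\<omega> \<in> space M. persist_chain \<theta> (\<lambda>i. X i \<omega>) n m y} = ennreal (persist \<theta> \<xi> n y)"
proof (induction n arbitrary: m y)
  case 0
  then show ?case by (simp add: emeasure_space_1)
next
  case (Suc n)
  have phi: "0 \<le> phi \<xi> x" for x
    using \<theta> by (simp add: phi_def)
  have "emeasure M {\<omega> \<in> space M. persist_chain \<theta> (\<lambda>i. X i \<omega>) (Suc n) m y} =
      (\<integral>\<^sup>+x. ennreal (phi \<xi> x) * (ennreal (persist \<theta> \<xi> n x) * indicator {\<theta> * y<..} x) \<partial>lborel)"
    by (intro emeasure_persist_chain_Suc ind dist Suc.IH) measurable
  also have "\<dots> = (\<integral>\<^sup>+x. ennreal (phi \<xi> x * persist \<theta> \<xi> n x) * indicator {\<theta> * y<..} x \<partial>lborel)"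
    using phi persist_nonneg[OF \<theta>] by (simp add: ennreal_mult mult.assoc)
  also have "\<dots> = ennreal (persist \<theta> \<xi> (Suc n) y)"
    by (intro nn_integral_persist \<theta>)
  finally show ?case .
qed

lemma (in prob_space) persist_prob_eq:
  fixes X :: "nat \<Rightarrow> 'a \<Rightarrow> real"
  assumes "indep_vars (\<lambda>_. borel) X UNIV"
    and "\<And>i. distributed M lborel (X i) (\<lambda>x. ennreal (phi \<xi> x))"
    and \<theta>: "\<theta> > 1" "0 \<le> \<xi>" "\<xi> \<le> 1"
  shows "persist_prob M X \<theta> y n = persist \<theta> \<xi> n y"
proof (cases n)
  case (Suc k)
  \<comment> \<open>With n = k + 1, the first comparison is with \<open>y\<close> and the other k
    are indexed from 2 to n.\<close>
  have "{2..<2 + k} = {2..n}" using Suc by auto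
  then have "persist_prob M X \<theta> y n
      = measure M {\<omega> \<in> space M. persist_chain \<theta> (\<lambda>i. X i \<omega>) n 2 y}"
    unfolding persist_prob_def Suc persist_chain_Suc_iff by simp
  then show ?thesis
    using emeasure_persist_chain[OF assms, of n 2 y] persist_nonneg[OF \<theta>, of n y]
    by (simp add: measure_def)
qed (simp add: persist_prob_def)

theorem lemma3p13:
  fixes M :: "'a measure" and X :: "nat \<Rightarrow> 'a \<Rightarrow> real"
    and \<theta> y \<xi> \<theta>bar lam :: real
  assumes "prob_space M"
    and "prob_space.indep_vars M (\<lambda>_. borel) X UNIV"
    and "\<And>i. distributed M lborel (X i) (\<lambda>x. ennreal (phi \<xi> x))"
    and "\<theta> > 1" and "0 < \<xi>" and "\<xi> \<le> 1"
    and "\<theta>bar = inverse \<theta>" and "lam = (1 - \<theta>bar) * \<xi>"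
  shows "(\<lambda>n. persist_prob M X \<theta> y n * lam * qpoch_inf \<theta>bar \<theta>bar / lam ^ (n + 1))
           \<longlonglongrightarrow> h_lim \<theta> \<xi> lam y"
proof -
  interpret prob_space M by fact
  note \<theta>bar = assms(7) and lam_def = assms(8)
  have q: "0 < \<theta>bar" "\<theta>bar < 1" using \<open>\<theta> > 1\<close> by (auto simp: \<theta>bar inverse_less_1_iff)
  then have lam: "lam > 0" using \<open>0 < \<xi>\<close> by (simp add: lam_def)
  let ?Q = "qpoch_inf \<theta>bar \<theta>bar"
  have "?Q \<noteq> 0" using q by (rule qpoch_inf_nonzero)
  have "(\<lambda>n. persist \<theta> \<xi> n y / lam ^ n * ?Q) \<longlonglongrightarrow> h_lim \<theta> \<xi> lam y"
  \<comment> \<open>The point y = 0 belongs to the second case, as in \<open>h_lim\<close>; there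
    \<open>persist\<close> is given by \<open>persist_pos\<close>, which agrees with
    \<open>persist_neg\<close> at 0.\<close>
  proof (cases "y > 0")
    case True
    then have "(\<lambda>n. persist_pos \<theta> \<xi> n y / lam ^ n * ?Q) \<longlonglongrightarrow> 0"
      using assms(4,6) lam by (intro tendsto_mult_left_zero persist_pos_limit) auto
    then show ?thesis using True by (simp add: persist_def h_lim_def)
  next
    case False
    then have "(\<lambda>n. persist_neg \<theta> \<xi> n y / lam ^ n) \<longlonglongrightarrow> q_exp \<theta> ((1 - \<xi>) / lam) / ?Q *
        (\<Sum>j. (- \<xi> / lam) ^ j / q_fact \<theta> j * exp (\<theta> * q_num \<theta> j * y))"
      unfolding \<theta>bar using assms(4,5) lam_def by (intro persist_neg_limit) (auto simp: \<theta>bar)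
    from tendsto_mult_right[OF this, of ?Q] show ?thesis
      using False \<open>?Q \<noteq> 0\<close> assms(4)
      by (simp add: persist_eq_neg h_lim_def q_num_def)
  qed
  moreover have "persist_prob M X \<theta> y n * lam * ?Q / lam ^ (n + 1) = persist \<theta> \<xi> n y / lam ^ n * ?Q" for n
    using persist_prob_eq[OF assms(2,3,4), of y n] assms(5,6) lam by simp
  ultimately show ?thesis by simp
qed

end
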